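(* Let $f:\mathbb{N}\to[1,+\infty)$ be a function, and let $F_f$ be the set of real numbers $\alpha\in(1,+\infty)$ such that for infinitely many integers $r\geq 1$ there exist integers $k_1\geq 2$, $k_2,\dots,k_r\geq 1$ with $$\left|\alpha-\zeta^\star(k_1,\dots,k_r)\right|<\sum_{n_1\geq\cdots\geq n_r\geq n_{r+1}\geq 2}\frac{1}{n_1^{k_1}\cdots n_r^{k_r}\,n_{r+1}^{f(r)}}.$$ Let $m$ denote Lebesgue measure on $\mathbb{R}$. (i) If the series $\sum_{r\geq 1}\frac{1}{2^{f(r)}}$ is convergent, then $m(F_f)=0$. (ii) If the series $\sum_{r\geq 1}\frac{1}{2^{f(r)}}$ is divergent, then $m\big((1,+\infty)\setminus F_f\big)=0$.
   Context: $\mathbb{N}=\{1,2,3,\dots\}$. For integers $r\geq 1$, $k_1\geq 2$ and $k_2,\dots,k_r\geq 1$, the multiple zeta-star value is $$\zeta^\star(k_1,\dots,k_r)=\sum_{n_1\geq\cdots\geq n_r\geq 1}\frac{1}{n_1^{k_1}\cdots n_r^{k_r}},$$ where all sums are over integers $n_i$. The paper phrases membership in $F_f$ as: the inequality holds "for infinitely many $r,k_1,\dots,k_r$ with $r\to+\infty$", i.e. it has solutions with arbitrarily large $r$. The values $f(r)$ are real numbers (not necessarily integers). *)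

theory Defs
  imports "HOL-Analysis.Analysis"
begin

definition weakly_decreasing_tuples :: "nat \<Rightarrow> nat \<Rightarrow> nat list set" where
  "weakly_decreasing_tuples a r =
     {ns. length ns = r \<and> sorted_wrt (\<ge>) ns \<and> (\<forall>n\<in>set ns. a \<le> n)}"

text \<open>Lists are indexed from 0, so \<open>ks ! i\<close> is $k_{i+1}$; the number of entries is $r$.\<close>

definition admissible :: "nat list \<Rightarrow> bool" where
  "admissible ks \<longleftrightarrow> length ks \<ge> 1 \<and> ks ! 0 \<ge> 2 \<and> (\<forall>k\<in>set ks. k \<ge> 1)"

text \<open>For admissible \<open>ks\<close> (and \<open>s \<ge> 1\<close>) the following two families of nonnegative reals are
  summable, so the convention that \<open>infsum\<close> is 0 for non-summable families plays no role.\<close>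

definition zeta_star :: "nat list \<Rightarrow> real" where
  "zeta_star ks =
     (\<Sum>\<^sub>\<infinity>ns\<in>weakly_decreasing_tuples 1 (length ks).
        1 / (\<Prod>i<length ks. real (ns ! i) ^ (ks ! i)))"

definition approx_radius :: "nat list \<Rightarrow> real \<Rightarrow> real" where
  "approx_radius ks s =
     (\<Sum>\<^sub>\<infinity>ns\<in>weakly_decreasing_tuples 2 (length ks + 1).
        1 / ((\<Prod>i<length ks. real (ns ! i) ^ (ks ! i)) * real (ns ! length ks) powr s))"

text \<open>Only the values \<open>f r\<close> with \<open>r \<ge> 1\<close> matter.\<close>

definition approximable_set :: "(nat \<Rightarrow> real) \<Rightarrow> real set" where
  "approximable_set f =
     {\<alpha>. \<alpha> > 1 \<and>
        infinite {r. r \<ge> 1 \<and>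
          (\<exists>ks. length ks = r \<and> admissible ks \<and>
             \<bar>\<alpha> - zeta_star ks\<bar> < approx_radius ks (f r))}}"

end

theory Submission
  imports Defs "HOL-Real_Asymp.Real_Asymp"
begin

text \<open>The intervals from \<open>\<zeta>\<^sup>\<star>(k\<^sub>1, \<dots>, k\<^sub>r)\<close> (excluded) to \<open>\<zeta>\<^sup>\<star>(k\<^sub>1, \<dots>, k\<^sub>r - 1)\<close> (included), called
  cylinders below, are for each \<open>r\<close> a partition of \<open>(1, \<infinity>)\<close>, so that the \<open>k\<^sub>i\<close> act as digits.
  The approximation radius with exponent \<open>s\<close> is at most \<open>2\<close> to the power \<open>-s\<close> times the length
  of the cylinder, and part (i) follows from the Borel-Cantelli lemma on bounded intervals.
  For part (ii), writing a cylinder length as a sum over the last summation index exhibits the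
  digits as the output of a hidden Markov chain: in the state \<open>m \<ge> 2\<close> the digit is geometric with
  ratio \<open>1 / m\<close> and the next state is uniform in \<open>{2..m}\<close>. The state is nonincreasing, hence
  eventually equal to 2, where the digits are independent and exceed \<open>s\<close> with probability
  \<open>2\<close> to the power \<open>-s\<close>; a digit exceeding the exponent by a bounded amount makes the
  approximation succeed.\<close>

section \<open>Sums of nonnegative families as integrals over counting measures\<close>

text \<open>Divergent families fit as well: \<open>infsum\<close> is then 0 by convention, and
  \<open>enn2real\<close> sends \<infinity> to 0. Estimates can thus be made in
  \<open>ennreal\<close>.\<close>

lemma infsum_conv_nn_integral:
  fixes f :: "'a \<Rightarrow> real"
  assumes "\<And>x. x \<in> A \<Longrightarrow> f x \<ge> 0"
  shows "infsum f A = enn2real (\<integral>\<^sup>+x. ennreal (f x) \<partial>count_space A)"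
proof (cases "(\<integral>\<^sup>+x. ennreal (f x) \<partial>count_space A) = \<infinity>")
  case True
  have "\<not> f summable_on A"
  proof
    assume "f summable_on A"
    then have "(\<lambda>x. norm (f x)) summable_on A"
      using assms by (subst summable_on_cong[of _ _ f]) auto
    then have "Infinite_Set_Sum.abs_summable_on f A"
      using abs_summable_equivalent by blast
    then have "integrable (count_space A) f"
      by (simp add: Infinite_Set_Sum.abs_summable_on_def)
    then have "(\<integral>\<^sup>+x. ennreal (norm (f x)) \<partial>count_space A) < \<infinity>"
      by (simp add: integrable_iff_bounded)
    moreover have "(\<integral>\<^sup>+x. ennreal (norm (f x)) \<partial>count_space A) = (\<integral>\<^sup>+x. ennreal (f x) \<partial>count_space A)"
      using assms by (intro nn_integral_cong) auto
    ultimately show False using True by simp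
  qed
  then show ?thesis using True by (simp add: infsum_not_exists)
next
  case False
  have "(\<integral>\<^sup>+x. ennreal (norm (f x)) \<partial>count_space A) = (\<integral>\<^sup>+x. ennreal (f x) \<partial>count_space A)"
    using assms by (intro nn_integral_cong) auto
  then have "integrable (count_space A) f"
    using False by (simp add: integrable_iff_bounded top.not_eq_extremum)
  then have "Infinite_Set_Sum.abs_summable_on f A"
    by (simp add: Infinite_Set_Sum.abs_summable_on_def)
  then show ?thesis
    using infsetsum_conv_nn_integral[of A f] infsetsum_infsum[of f A] False assms by simp
qed

lemma nn_integral_count_space_Sigma:
  "(\<integral>\<^sup>+z. f z \<partial>count_space (Sigma A B)) =
    (\<integral>\<^sup>+x. (\<integral>\<^sup>+y. f (x, y) \<partial>count_space (B x)) \<partial>count_space A)"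
proof -
  have "(\<integral>\<^sup>+z. f z \<partial>count_space (Sigma A B)) =
      (\<integral>\<^sup>+z. f z * indicator (Sigma A B) z \<partial>count_space UNIV)"
    by (simp add: nn_integral_count_space_indicator)
  also have "\<dots> = (\<integral>\<^sup>+x. \<integral>\<^sup>+y. f (x, y) * indicator (Sigma A B) (x, y) \<partial>count_space UNIV \<partial>count_space UNIV)"
    by (simp add: nn_integral_fst_count_space[symmetric])
  also have "\<dots> = (\<integral>\<^sup>+x. (\<integral>\<^sup>+y. f (x, y) * indicator (B x) y \<partial>count_space UNIV) * indicator A x \<partial>count_space UNIV)"
    by (intro nn_integral_cong) (auto simp: indicator_def intro!: nn_integral_cong)
  also have "\<dots> = (\<integral>\<^sup>+x. (\<integral>\<^sup>+y. f (x, y) \<partial>count_space (B x)) \<partial>count_space A)"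
    by (simp add: nn_integral_count_space_indicator)
  finally show ?thesis .
qed

lemma nn_integral_telescope:
  fixes g :: "nat \<Rightarrow> real"
  assumes "\<And>m. m \<ge> n \<Longrightarrow> g (Suc m) \<le> g m" "g \<longlonglongrightarrow> 0"
  shows "(\<integral>\<^sup>+m. ennreal (g m - g (Suc m)) \<partial>count_space {n..}) = ennreal (g n)"
proof -
  have bij: "bij_betw (\<lambda>i. i + n) UNIV {n..}"
    by (rule bij_betwI[where g="\<lambda>i. i - n"]) auto
  have "(\<lambda>i. g (i + n)) \<longlonglongrightarrow> 0"
    using assms(2) by (rule LIMSEQ_ignore_initial_segment)
  from telescope_sums'[OF this]
  have s: "(\<lambda>i. g (i + n) - g (Suc (i + n))) sums g n" by simp
  have "(\<integral>\<^sup>+m. ennreal (g m - g (Suc m)) \<partial>count_space {n..}) =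
      (\<integral>\<^sup>+i. ennreal (g (i + n) - g (Suc (i + n))) \<partial>count_space UNIV)"
    by (simp add: nn_integral_bij_count_space[OF bij, symmetric])
  also have "\<dots> = (\<Sum>i. ennreal (g (i + n) - g (Suc (i + n))))"
    by (rule nn_integral_count_space_nat)
  also have "\<dots> = ennreal (g n)"
    using s assms(1) by (subst suminf_ennreal2) (auto simp: sums_iff)
  finally show ?thesis .
qed

text \<open>Partial fractions give \<open>1 / (m - 1) - 1 / m\<close>. This is the majorant behind
  the upper bounds for tail sums.\<close>

lemma nn_integral_inverse_pred_mult:
  assumes "n \<ge> 2"
  shows "(\<integral>\<^sup>+m. ennreal (1 / (real m * (real m - 1))) \<partial>count_space {n..}) = ennreal (1 / (real n - 1))"
proof -
  have "(\<lambda>m. 1 / (real m - 1)) \<longlonglongrightarrow> 0" by real_asymp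
  then have "(\<integral>\<^sup>+m. ennreal (1 / (real m - 1) - 1 / (real (Suc m) - 1)) \<partial>count_space {n..}) = ennreal (1 / (real n - 1))"
    using assms by (intro nn_integral_telescope[where g="\<lambda>m. 1 / (real m - 1)"]) (auto simp: field_simps)
  moreover have "1 / (real m - 1) - 1 / (real (Suc m) - 1) = 1 / (real m * (real m - 1))" if "m \<ge> n" for m
    using that assms by (simp add: field_simps)
  ultimately show ?thesis by (simp cong: nn_integral_cong_simp)
qed

text \<open>The counterpart for lower bounds, from \<open>1 / m - 1 / (m + 1)\<close>.\<close>

lemma nn_integral_inverse_mult_Suc:
  assumes "n \<ge> 1"
  shows "(\<integral>\<^sup>+m. ennreal (1 / (real m * (real m + 1))) \<partial>count_space {n..}) = ennreal (1 / real n)"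
proof -
  have "(\<lambda>m. 1 / real m) \<longlonglongrightarrow> 0" by real_asymp
  then have "(\<integral>\<^sup>+m. ennreal (1 / real m - 1 / real (Suc m)) \<partial>count_space {n..}) = ennreal (1 / real n)"
    using assms by (intro nn_integral_telescope[where g="\<lambda>m. 1 / real m"]) (auto simp: field_simps)
  moreover have "1 / real m - 1 / real (Suc m) = 1 / (real m * (real m + 1))" if "m \<ge> n" for m
    using that assms by (simp add: field_simps)
  ultimately show ?thesis by (simp cong: nn_integral_cong_simp)
qed

section \<open>Tail sums, excesses and their recursions\<close>

definition tuple_weight :: "nat list \<Rightarrow> nat list \<Rightarrow> real" where
  "tuple_weight ks ns = 1 / (\<Prod>i<length ks. real (ns ! i) ^ (ks ! i))"

text \<open>With \<open>a = 1\<close> this is the zeta-star sum. The variable lower bound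
  \<open>a\<close> makes a recursion on the last entry possible, and values in
  \<open>ennreal\<close> keep divergent sums meaningful.\<close>

definition tail_sum :: "nat list \<Rightarrow> nat \<Rightarrow> ennreal" where
  "tail_sum ks a = (\<integral>\<^sup>+ns. ennreal (tuple_weight ks ns)
      \<partial>count_space (weakly_decreasing_tuples a (length ks)))"

text \<open>The approximation radius before conversion to \<open>real\<close>. For a natural number
  \<open>s = k\<close> it is also the amount by which appending the digit \<open>k\<close> raises
  the zeta-star sum, and for \<open>s = 0\<close> it is the length of the cylinder.\<close>

definition excess :: "nat list \<Rightarrow> real \<Rightarrow> ennreal" where
  "excess ks s = (\<integral>\<^sup>+m. tail_sum ks m * ennreal (real m powr - s) \<partial>count_space {2..})"

lemma tuple_weight_nonneg: "tuple_weight ks ns \<ge> 0"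
  by (simp add: tuple_weight_def prod_nonneg)

lemma tuple_weight_snoc:
  assumes "length ns = length ks"
  shows "tuple_weight (ks @ [k]) (ns @ [m]) = tuple_weight ks ns * (1 / real m ^ k)"
proof -
  have "(\<Prod>i<length ks. real ((ns @ [m]) ! i) ^ ((ks @ [k]) ! i)) = (\<Prod>i<length ks. real (ns ! i) ^ (ks ! i))"
    using assms by (intro prod.cong) (auto simp: nth_append)
  then show ?thesis using assms
    by (simp add: tuple_weight_def nth_append)
qed

lemma tail_sum_Nil [simp]: "tail_sum [] a = 1"
proof -
  have "weakly_decreasing_tuples a 0 = {[]}"
    by (auto simp: weakly_decreasing_tuples_def)
  then show ?thesis
    by (simp add: tail_sum_def tuple_weight_def nn_integral_count_space_finite)
qed

text \<open>The last entry \<open>m\<close> is the smallest, so the other entries form an arbitrary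
  weakly decreasing tuple bounded below by \<open>m\<close>.\<close>

lemma nn_integral_weakly_decreasing_tuples_Suc:
  "(\<integral>\<^sup>+ns. f ns \<partial>count_space (weakly_decreasing_tuples a (Suc r))) =
    (\<integral>\<^sup>+m. (\<integral>\<^sup>+ns. f (ns @ [m]) \<partial>count_space (weakly_decreasing_tuples m r)) \<partial>count_space {a..})"
proof -
  have bij: "bij_betw (\<lambda>(m, ns). ns @ [m]) (Sigma {a..} (\<lambda>m. weakly_decreasing_tuples m r))
      (weakly_decreasing_tuples a (Suc r))"
  proof (rule bij_betwI[where g="\<lambda>ns. (last ns, butlast ns)"])
    show "(\<lambda>ns. (last ns, butlast ns)) \<in> weakly_decreasing_tuples a (Suc r) \<rightarrow>
        Sigma {a..} (\<lambda>m. weakly_decreasing_tuples m r)"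
    proof
      fix ns assume ns: "ns \<in> weakly_decreasing_tuples a (Suc r)"
      then have "ns = butlast ns @ [last ns]" 
        by (intro append_butlast_last_id[symmetric]) (auto simp: weakly_decreasing_tuples_def)
      then obtain ms m where "ns = ms @ [m]" by blast
      with ns show "(last ns, butlast ns) \<in> Sigma {a..} (\<lambda>m. weakly_decreasing_tuples m r)"
        by (auto simp: weakly_decreasing_tuples_def sorted_wrt_append)
    qed
  next
    fix ns assume "ns \<in> weakly_decreasing_tuples a (Suc r)"
    then have "ns \<noteq> []" by (auto simp: weakly_decreasing_tuples_def)
    then show "(case (last ns, butlast ns) of (m, ns) \<Rightarrow> ns @ [m]) = ns" by simp
  qed (fastforce simp: weakly_decreasing_tuples_def sorted_wrt_append)+
  show ?thesis
    by (simp add: nn_integral_bij_count_space[OF bij, symmetric] nn_integral_count_space_Sigma)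
qed

lemma tail_sum_snoc:
  "tail_sum (ks @ [k]) a = (\<integral>\<^sup>+m. tail_sum ks m * ennreal (1 / real m ^ k) \<partial>count_space {a..})"
proof -
  have "tail_sum (ks @ [k]) a = (\<integral>\<^sup>+m. (\<integral>\<^sup>+ns. ennreal (tuple_weight (ks @ [k]) (ns @ [m]))
      \<partial>count_space (weakly_decreasing_tuples m (length ks))) \<partial>count_space {a..})"
    by (simp add: tail_sum_def nn_integral_weakly_decreasing_tuples_Suc)
  also have "\<dots> = (\<integral>\<^sup>+m. (\<integral>\<^sup>+ns. ennreal (tuple_weight ks ns) * ennreal (1 / real m ^ k)
      \<partial>count_space (weakly_decreasing_tuples m (length ks))) \<partial>count_space {a..})"
    by (intro nn_integral_cong)
      (auto simp: weakly_decreasing_tuples_def tuple_weight_snoc ennreal_mult[symmetric] tuple_weight_nonneg)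
  also have "\<dots> = (\<integral>\<^sup>+m. tail_sum ks m * ennreal (1 / real m ^ k) \<partial>count_space {a..})"
    by (simp add: tail_sum_def nn_integral_multc)
  finally show ?thesis .
qed

lemma zeta_star_eq: "zeta_star ks = enn2real (tail_sum ks 1)"
  unfolding zeta_star_def tail_sum_def tuple_weight_def[symmetric]
  by (intro infsum_conv_nn_integral tuple_weight_nonneg)

lemma approx_radius_eq: "approx_radius ks s = enn2real (excess ks s)"
proof -
  let ?F = "\<lambda>ns. 1 / ((\<Prod>i<length ks. real (ns ! i) ^ (ks ! i)) * real (ns ! length ks) powr s)"
  have F: "?F ns = tuple_weight ks ns * real (ns ! length ks) powr - s" for ns
    by (simp add: tuple_weight_def powr_minus field_simps)
  have nth_append_length_eq: "(ns @ [m]) ! length ks = m" if "length ns = length ks" for ns m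
    using that by (metis nth_append_length)
  have w: "tuple_weight ks (ns @ [m]) = tuple_weight ks ns" if "length ns = length ks" for ns m
    using that unfolding tuple_weight_def by (auto simp: nth_append)
  have "approx_radius ks s = enn2real (\<integral>\<^sup>+ns. ennreal (?F ns) \<partial>count_space (weakly_decreasing_tuples 2 (Suc (length ks))))"
    unfolding approx_radius_def by (subst infsum_conv_nn_integral) (auto simp: prod_nonneg)
  also have "(\<integral>\<^sup>+ns. ennreal (?F ns) \<partial>count_space (weakly_decreasing_tuples 2 (Suc (length ks)))) =
     (\<integral>\<^sup>+m. (\<integral>\<^sup>+ns. ennreal (?F (ns @ [m])) \<partial>count_space (weakly_decreasing_tuples m (length ks))) \<partial>count_space {2..})"
    by (rule nn_integral_weakly_decreasing_tuples_Suc)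
  also have "\<dots> = (\<integral>\<^sup>+m. (\<integral>\<^sup>+ns. ennreal (tuple_weight ks ns) * ennreal (real m powr - s)
      \<partial>count_space (weakly_decreasing_tuples m (length ks))) \<partial>count_space {2..})"
    unfolding F
    by (intro nn_integral_cong)
      (auto simp: weakly_decreasing_tuples_def w nth_append_length_eq ennreal_mult[symmetric] tuple_weight_nonneg)
  also have "\<dots> = excess ks s"
    by (simp add: tail_sum_def excess_def nn_integral_multc)
  finally show ?thesis .
qed

text \<open>Interchange of the sums over \<open>n \<le> m\<close>. This is the transition of the
  hidden chain: emitting \<open>k\<close> in the state \<open>m\<close> and moving to
  \<open>n\<close> in \<open>{2..m}\<close> has weight \<open>1 / m ^ k\<close>, which is
  \<open>(m - 1) / m ^ k\<close> times \<open>1 / (m - 1)\<close>.\<close>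

lemma nn_integral_tail_sum_snoc:
  assumes "\<And>n. q n \<ge> 0"
  shows "(\<integral>\<^sup>+n. tail_sum (ks @ [k]) n * ennreal (q n) \<partial>count_space {2..}) =
    (\<integral>\<^sup>+m. tail_sum ks m * ennreal (1 / real m ^ k * (\<Sum>n=2..m. q n)) \<partial>count_space {2..})"
proof -
  let ?h = "\<lambda>m n. tail_sum ks m * ennreal (1 / real m ^ k) * (ennreal (q n) * indicator {..m} n)"
  have "tail_sum (ks @ [k]) n * ennreal (q n) = (\<integral>\<^sup>+m. ?h m n \<partial>count_space {2..})" if "n \<ge> 2" for n
  proof -
    have "tail_sum (ks @ [k]) n =
        (\<integral>\<^sup>+m. tail_sum ks m * ennreal (1 / real m ^ k) * indicator {..m} n \<partial>count_space {2..})"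
      unfolding tail_sum_snoc using that
      by (auto simp: nn_integral_count_space_indicator indicator_def intro!: nn_integral_cong)
    then have "tail_sum (ks @ [k]) n * ennreal (q n) =
        (\<integral>\<^sup>+m. tail_sum ks m * ennreal (1 / real m ^ k) * indicator {..m} n * ennreal (q n) \<partial>count_space {2..})"
      by (simp add: nn_integral_multc)
    then show ?thesis by (simp add: mult_ac)
  qed
  then have "(\<integral>\<^sup>+n. tail_sum (ks @ [k]) n * ennreal (q n) \<partial>count_space {2..}) =
      (\<integral>\<^sup>+n. (\<integral>\<^sup>+m. ?h m n \<partial>count_space {2..}) \<partial>count_space {2..})"
    by (intro nn_integral_cong) auto
  also have "\<dots> = (\<integral>\<^sup>+m. (\<integral>\<^sup>+n. ?h m n \<partial>count_space {2..}) \<partial>count_space {2..})"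
    by (rule nn_integral_count_space_nn_integral) auto
  also have "\<dots> = (\<integral>\<^sup>+m. tail_sum ks m * ennreal (1 / real m ^ k * (\<Sum>n=2..m. q n)) \<partial>count_space {2..})"
  proof (intro nn_integral_cong)
    fix m :: nat
    have "(\<integral>\<^sup>+n. ennreal (q n) * indicator {..m} n \<partial>count_space {2..}) =
        (\<Sum>n=2..m. ennreal (q n) * indicator {..m} n)"
      by (rule nn_integral_count_space') auto
    also have "\<dots> = (\<Sum>n=2..m. ennreal (q n))"
      by (intro sum.cong) auto
    also have "\<dots> = ennreal (\<Sum>n=2..m. q n)"
      using assms by (intro sum_ennreal) auto
    finally show "(\<integral>\<^sup>+n. ?h m n \<partial>count_space {2..}) =
        tail_sum ks m * ennreal (1 / real m ^ k * (\<Sum>n=2..m. q n))"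
      using assms by (simp add: nn_integral_cmult mult.assoc sum_nonneg ennreal_mult[symmetric])
  qed
  finally show ?thesis .
qed

lemma powr_minus_of_nat: "m \<ge> 2 \<Longrightarrow> real m powr - real k = 1 / real m ^ k"
  by (simp add: powr_minus powr_realpow field_simps)

lemma excess_0: "excess ks 0 = (\<integral>\<^sup>+m. tail_sum ks m \<partial>count_space {2..})"
  unfolding excess_def by (intro nn_integral_cong) auto

lemma excess_of_nat:
  "excess ks (real k) = (\<integral>\<^sup>+m. tail_sum ks m * ennreal (1 / real m ^ k) \<partial>count_space {2..})"
  unfolding excess_def by (intro nn_integral_cong) (simp add: powr_minus_of_nat)

text \<open>The index \<open>m = 1\<close> has weight 1 and contributes the old value; the indices
  from 2 on make up the excess.\<close>

lemma tail_sum_snoc_1: "tail_sum (ks @ [k]) 1 = tail_sum ks 1 + excess ks (real k)"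
proof -
  let ?f = "\<lambda>m. tail_sum ks m * ennreal (1 / real m ^ k)"
  have "{1::nat..} = {1} \<union> {2..}" by auto
  then have "tail_sum (ks @ [k]) 1 = (\<integral>\<^sup>+m. ?f m \<partial>count_space ({1} \<union> {2..}))"
    by (simp add: tail_sum_snoc)
  also have "\<dots> = (\<integral>\<^sup>+m. ?f m \<partial>count_space {1}) + (\<integral>\<^sup>+m. ?f m \<partial>count_space {2..})"
    using nn_integral_disjoint_pair_countspace[of "{1}" "{2..}" ?f]
    by (simp add: nn_integral_count_space_indicator)
  also have "\<dots> = tail_sum ks 1 + excess ks (real k)"
    by (simp add: nn_integral_count_space_finite excess_of_nat)
  finally show ?thesis .
qed

text \<open>The range \<open>{2..m}\<close> has \<open>m - 1\<close> elements, and
  \<open>(m - 1) / m ^ (k + 1) + 1 / m ^ (k + 1) = 1 / m ^ k\<close>. The additive form avoids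
  subtraction, which misbehaves at \<infinity>.\<close>

lemma excess_snoc_0: "excess (ks @ [Suc k]) 0 + excess ks (real (Suc k)) = excess ks (real k)"
proof -
  have "excess (ks @ [Suc k]) 0 =
      (\<integral>\<^sup>+m. tail_sum ks m * ennreal (1 / real m ^ Suc k * (\<Sum>n=2..m. 1)) \<partial>count_space {2..})"
    unfolding excess_0 using nn_integral_tail_sum_snoc[of "\<lambda>_. 1" ks "Suc k"] by simp
  then have "excess (ks @ [Suc k]) 0 + excess ks (real (Suc k)) =
      (\<integral>\<^sup>+m. tail_sum ks m * ennreal (1 / real m ^ Suc k * (\<Sum>n=2..m. 1)) +
             tail_sum ks m * ennreal (1 / real m ^ Suc k) \<partial>count_space {2..})"
    by (simp add: excess_of_nat nn_integral_add del: sum_constant of_nat_Suc power_Suc)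
  also have "\<dots> = (\<integral>\<^sup>+m. tail_sum ks m * ennreal (1 / real m ^ k) \<partial>count_space {2..})"
  proof (intro nn_integral_cong)
    fix m assume "m \<in> space (count_space {2::nat..})"
    then have "1 / real m ^ Suc k * (\<Sum>n=2..m. 1) + 1 / real m ^ Suc k = 1 / real m ^ k"
      by (simp add: field_simps of_nat_diff)
    then have "ennreal (1 / real m ^ Suc k * (\<Sum>n=2..m. 1)) + ennreal (1 / real m ^ Suc k) = ennreal (1 / real m ^ k)"
      by (subst ennreal_plus[symmetric]) auto
    then show "tail_sum ks m * ennreal (1 / real m ^ Suc k * (\<Sum>n=2..m. 1)) +
             tail_sum ks m * ennreal (1 / real m ^ Suc k) = tail_sum ks m * ennreal (1 / real m ^ k)"
      by (metis distrib_left)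
  qed
  finally show ?thesis by (simp add: excess_of_nat)
qed

text \<open>Every index is at least 2, which is the origin of the base 2 in the theorem. With
  \<open>s = 0\<close> this compares the radius to the cylinder length.\<close>

lemma excess_le_powr:
  assumes "s \<le> t"
  shows "excess ks t \<le> ennreal (2 powr - (t - s)) * excess ks s"
proof -
  have "excess ks t \<le> (\<integral>\<^sup>+m. ennreal (2 powr - (t - s)) * (tail_sum ks m * ennreal (real m powr - s)) \<partial>count_space {2..})"
    unfolding excess_def
  proof (intro nn_integral_mono)
    fix m assume m: "m \<in> space (count_space {2::nat..})"
    have "real m powr - t = real m powr - (t - s) * real m powr - s"
      using m by (simp flip: powr_add)
    also have "real m powr - (t - s) \<le> 2 powr - (t - s)"
      using m assms by (intro powr_mono2') auto
    finally have "real m powr - t \<le> 2 powr - (t - s) * real m powr - s"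
      by (simp add: mult_right_mono)
    then have "ennreal (real m powr - t) \<le> ennreal (2 powr - (t - s)) * ennreal (real m powr - s)"
      by (simp add: ennreal_mult[symmetric] ennreal_leI)
    then show "tail_sum ks m * ennreal (real m powr - t) \<le>
        ennreal (2 powr - (t - s)) * (tail_sum ks m * ennreal (real m powr - s))"
      by (metis mult_left_mono mult.left_commute zero_le)
  qed
  also have "\<dots> = ennreal (2 powr - (t - s)) * excess ks s"
    by (simp add: excess_def nn_integral_cmult)
  finally show ?thesis .
qed

lemma excess_antimono: "s \<le> t \<Longrightarrow> excess ks t \<le> excess ks s"
  unfolding excess_def
  by (intro nn_integral_mono mult_left_mono ennreal_leI powr_mono) auto

section \<open>Bounds for admissible tuples\<close>

text \<open>The empty tuple is included as the root of the tree of digits; its cylinder is the whole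
  of \<open>(1, \<infinity>)\<close>.\<close>

definition admissible_prefix :: "nat list \<Rightarrow> bool" where
  "admissible_prefix ks \<longleftrightarrow> ks = [] \<or> admissible ks"

lemma admissible_snoc:
  "admissible (ks @ [k]) \<longleftrightarrow> (if ks = [] then k \<ge> 2 else admissible ks \<and> k \<ge> 1)"
  by (cases ks) (auto simp: admissible_def)

lemma admissible_prefix_snoc:
  "admissible_prefix (ks @ [k]) \<longleftrightarrow> (if ks = [] then k \<ge> 2 else admissible_prefix ks \<and> k \<ge> 1)"
  by (simp add: admissible_prefix_def admissible_snoc)

lemma excess_Nil_le_1:
  assumes "s \<ge> 2"
  shows "excess [] s \<le> 1"
proof -
  have "excess [] s \<le> excess [] (real 2)"
    using assms by (intro excess_antimono) simp
  also have "\<dots> \<le> (\<integral>\<^sup>+m. ennreal (1 / (real m * (real m - 1))) \<partial>count_space {2..})"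
    unfolding excess_of_nat
    by (intro nn_integral_mono) (auto simp: power2_eq_square intro!: ennreal_leI divide_left_mono mult_left_mono)
  also have "\<dots> = 1"
    by (simp add: nn_integral_inverse_pred_mult)
  finally show ?thesis .
qed

text \<open>The bound \<open>1 / (m - 1)\<close> times \<open>1 / m\<close> is the telescoping term
  whose sum from \<open>n\<close> is \<open>1 / (n - 1)\<close>, so the bound reproduces itself. The
  first digit starts from the tail sum 1 and makes up for it by being at least 2.\<close>

lemma tail_sum_le:
  assumes "admissible ks" "n \<ge> 2"
  shows "tail_sum ks n \<le> ennreal (1 / (real n - 1))"
  using assms
proof (induction ks arbitrary: n rule: rev_induct)
  case Nil
  then show ?case by (simp add: admissible_def)
next
  case (snoc k ks)
  have "tail_sum (ks @ [k]) n \<le> (\<integral>\<^sup>+m. ennreal (1 / (real m * (real m - 1))) \<partial>count_space {n..})"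
    unfolding tail_sum_snoc
  proof (intro nn_integral_mono)
    fix m assume "m \<in> space (count_space {n..})"
    then have m: "m \<ge> 2" using snoc.prems by simp
    show "tail_sum ks m * ennreal (1 / real m ^ k) \<le> ennreal (1 / (real m * (real m - 1)))"
    proof (cases "ks = []")
      case True
      then have "real m ^ 2 \<le> real m ^ k"
        using snoc.prems admissible_snoc[of ks k] m by (intro power_increasing) auto
      moreover have "real m * (real m - 1) \<le> real m ^ 2"
        using m by (simp add: power2_eq_square)
      ultimately have "real m * (real m - 1) \<le> real m ^ k" by linarith
      then show ?thesis using True m
        by (auto intro!: ennreal_leI divide_left_mono mult_pos_pos)
    next
      case False
      then have *: "admissible ks" "k \<ge> 1" using snoc.prems by (auto simp: admissible_snoc)
      have "real m ^ 1 \<le> real m ^ k" using * m by (intro power_increasing) auto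
      then have "1 / real m ^ k \<le> 1 / real m" using m by (intro divide_left_mono) auto
      then have "tail_sum ks m * ennreal (1 / real m ^ k) \<le> ennreal (1 / (real m - 1)) * ennreal (1 / real m)"
        using snoc.IH[OF *(1) m] by (intro mult_mono ennreal_leI) auto
      also have "\<dots> = ennreal (1 / (real m * (real m - 1)))"
        using m by (simp add: ennreal_mult[symmetric] mult.commute)
      finally show ?thesis .
    qed
  qed
  also have "\<dots> = ennreal (1 / (real n - 1))"
    using snoc.prems by (intro nn_integral_inverse_pred_mult) simp
  finally show ?case .
qed

lemma excess_le_1:
  assumes "admissible ks" "s \<ge> 1"
  shows "excess ks s \<le> 1"
proof -
  have "excess ks s \<le> excess ks (real 1)"
    using assms by (intro excess_antimono) simp
  also have "\<dots> \<le> (\<integral>\<^sup>+m. ennreal (1 / (real m * (real m - 1))) \<partial>count_space {2..})"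
    unfolding excess_of_nat
  proof (intro nn_integral_mono)
    fix m assume "m \<in> space (count_space {2::nat..})"
    then have m: "m \<ge> 2" by simp
    have "tail_sum ks m * ennreal (1 / real m ^ 1) \<le> ennreal (1 / (real m - 1)) * ennreal (1 / real m)"
      using tail_sum_le[OF assms(1) m] by (intro mult_mono) auto
    also have "\<dots> = ennreal (1 / (real m * (real m - 1)))"
      using m by (simp add: ennreal_mult[symmetric] mult.commute)
    finally show "tail_sum ks m * ennreal (1 / real m ^ 1) \<le> ennreal (1 / (real m * (real m - 1)))" .
  qed
  also have "\<dots> = 1"
    by (simp add: nn_integral_inverse_pred_mult)
  finally show ?thesis .
qed

lemma excess_prefix_le_1:
  assumes "admissible_prefix ks" "s \<ge> 2"
  shows "excess ks s \<le> 1"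
  using assms excess_Nil_le_1 excess_le_1 by (auto simp: admissible_prefix_def)

text \<open>Each appended digit raises the sum by at most 1.\<close>

lemma tail_sum_1_finite:
  assumes "admissible_prefix ks"
  shows "tail_sum ks 1 < \<infinity>"
  using assms
proof (induction ks rule: rev_induct)
  case Nil
  then show ?case by simp
next
  case (snoc k ks)
  have "ks = [] \<and> k \<ge> 2 \<or> admissible ks \<and> k \<ge> 1"
    using snoc.prems admissible_snoc[of ks k] by (cases "ks = []") (simp_all add: admissible_prefix_def)
  then have "excess ks (real k) \<le> 1" "tail_sum ks 1 < \<infinity>"
    using snoc.IH excess_Nil_le_1[of "real k"] excess_le_1[of ks "real k"]
    by (auto simp: admissible_prefix_def)
  then show ?case
    unfolding tail_sum_snoc_1 by (auto simp: top.not_eq_extremum[symmetric] ennreal_add_eq_top top_unique)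
qed

lemma tail_sum_1_eq_zeta_star:
  assumes "admissible_prefix ks"
  shows "tail_sum ks 1 = ennreal (zeta_star ks)"
  using tail_sum_1_finite[OF assms] by (simp add: zeta_star_eq)

lemma zeta_star_nonneg: "zeta_star ks \<ge> 0"
  by (simp add: zeta_star_eq)

text \<open>The second alternative is that of the tuples \<open>(2, 1, \<dots>, 1)\<close>, whose cylinders are
  unbounded.\<close>

lemma excess_le_1_or_tail_sum_ge:
  assumes "admissible_prefix ks"
  shows "excess ks 0 \<le> 1 \<or>
    (\<forall>n\<ge>1. ennreal (1 / real n) \<le> tail_sum ks n) \<and> ennreal (1 + real (length ks) / 2) \<le> tail_sum ks 1"
  using assms
proof (induction ks rule: rev_induct)
  case Nil
  then show ?case by (auto simp: ennreal_1[symmetric] simp del: ennreal_1 intro!: ennreal_leI)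
next
  case (snoc k ks)
  have ap: "admissible_prefix ks" and k: "k \<ge> 1" "ks = [] \<Longrightarrow> k \<ge> 2"
    using snoc.prems admissible_prefix_snoc[of ks k]
    by (auto simp: admissible_prefix_def[of "[]"] simp del: append_self_conv2 split: if_splits)
  obtain j where j: "k = Suc j" using k by (cases k) auto
  have le: "excess (ks @ [k]) 0 \<le> excess ks (real j)"
    unfolding j excess_snoc_0[of ks j, symmetric] by simp
  show ?case
  proof (cases "excess ks (real j) \<le> 1")
    case True
    then show ?thesis using le by auto
  next
    case False
    have "excess ks 0 > 1"
      using False excess_antimono[of 0 "real j" ks] by (simp add: not_le)
    then have lower: "\<forall>n\<ge>1. ennreal (1 / real n) \<le> tail_sum ks n"
        "ennreal (1 + real (length ks) / 2) \<le> tail_sum ks 1"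
      using snoc.IH[OF ap] by (auto simp: not_le)
    \<comment> \<open>Only a first digit 2 or a later digit 1 is left: for any larger digit the
      bounds for admissible prefixes apply at \<open>j\<close>.\<close>
    have j_le: "j = 0 \<or> (ks = [] \<and> j = 1)"
    proof (rule ccontr)
      assume "\<not> (j = 0 \<or> (ks = [] \<and> j = 1))"
      then have "excess ks (real j) \<le> 1"
        using ap by (cases "ks = []") (auto simp: admissible_prefix_def intro!: excess_Nil_le_1 excess_le_1)
      with False show False by simp
    qed
    \<comment> \<open>The telescoping minorant sums to \<open>1 / n\<close> from \<open>n\<close>
      on, which preserves the lower bound, and to \<open>1 / 2\<close> from 2 on, which is the gain
      per digit.\<close>
    have *: "ennreal (1 / (real m * (real m + 1))) \<le> tail_sum ks m * ennreal (1 / real m ^ k)" if "m \<ge> 1" for m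
    proof -
      have "1 / (real m * (real m + 1)) \<le> 1 / (real m * real m)"
        using that by (intro divide_left_mono mult_left_mono mult_pos_pos) auto
      then have "ennreal (1 / (real m * (real m + 1))) \<le> ennreal (1 / (real m * real m))"
        by (rule ennreal_leI)
      also have "\<dots> \<le> tail_sum ks m * ennreal (1 / real m ^ k)"
      proof (cases "ks = []")
        case True
        then show ?thesis using j_le j k by (auto simp: power2_eq_square)
      next
        case False
        then have "k = 1" using j_le j by simp
        have "ennreal (1 / (real m * real m)) = ennreal (1 / real m) * ennreal (1 / real m)"
          by (simp add: ennreal_mult[symmetric])
        also have "\<dots> \<le> tail_sum ks m * ennreal (1 / real m)"
          using lower(1) that by (intro mult_right_mono) auto
        finally show ?thesis using \<open>k = 1\<close> by simp
      qed
      finally show ?thesis .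
    qed
    have "ennreal (1 / real n) \<le> tail_sum (ks @ [k]) n" if "n \<ge> 1" for n
    proof -
      have "ennreal (1 / real n) = (\<integral>\<^sup>+m. ennreal (1 / (real m * (real m + 1))) \<partial>count_space {n..})"
        using nn_integral_inverse_mult_Suc[OF that] by simp
      also have "\<dots> \<le> tail_sum (ks @ [k]) n"
        unfolding tail_sum_snoc using that by (intro nn_integral_mono *) auto
      finally show ?thesis .
    qed
    moreover have "ennreal (1 + real (length (ks @ [k])) / 2) \<le> tail_sum (ks @ [k]) 1"
    proof -
      have "ennreal (1 / 2) = (\<integral>\<^sup>+m. ennreal (1 / (real m * (real m + 1))) \<partial>count_space {2..})"
        using nn_integral_inverse_mult_Suc[of 2] by simp
      also have "\<dots> \<le> excess ks (real k)"
        unfolding excess_of_nat by (intro nn_integral_mono *) auto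
      finally have "ennreal (1 + real (length ks) / 2) + ennreal (1 / 2) \<le> tail_sum (ks @ [k]) 1"
        unfolding tail_sum_snoc_1 using lower(2) by (intro add_mono)
      moreover have "ennreal (1 + real (length ks) / 2) + ennreal (1 / 2) = ennreal (1 + real (length (ks @ [k])) / 2)"
        by (subst ennreal_plus[symmetric]) (auto simp: field_simps)
      ultimately show ?thesis by (simp only:)
    qed
    ultimately show ?thesis by blast
  qed
qed

text \<open>The harmonic series. Its divergence makes the root cylinder unbounded and rules out 1 as
  a first digit.\<close>

lemma excess_Nil_1: "excess [] 1 = \<infinity>"
proof (rule ccontr)
  assume "excess [] 1 \<noteq> \<infinity>"
  moreover have bij: "bij_betw (\<lambda>i. i + 2) UNIV {2::nat..}"
    by (rule bij_betwI[where g="\<lambda>i. i - 2"]) auto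
  have "excess [] 1 = (\<integral>\<^sup>+m. ennreal (1 / real m) \<partial>count_space {2..})"
    using excess_of_nat[of "[]" 1] by simp
  also have "\<dots> = (\<integral>\<^sup>+i. ennreal (1 / real (i + 2)) \<partial>count_space UNIV)"
    by (rule nn_integral_bij_count_space[OF bij, symmetric])
  also have "\<dots> = (\<Sum>i. ennreal (1 / real (i + 2)))"
    by (rule nn_integral_count_space_nat)
  ultimately have "summable (\<lambda>i. 1 / real (i + 2))"
    by (intro summable_suminf_not_top) auto
  then have "summable (\<lambda>i. 1 / real i)"
    by (subst (asm) summable_iff_shift)
  then show False
    using not_summable_harmonic[where 'a=real] by (simp add: inverse_eq_divide)
qed

section \<open>Cylinders and the digit expansion\<close>

text \<open>The right end is the zeta-star sum with the last digit lowered by one, by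
  \<open>tail_sum_snoc_1\<close> and \<open>excess_snoc_0\<close>. Comparison in
  \<open>ennreal\<close> admits an infinite right end, and the strict lower bound excludes negative
  \<open>x\<close>, which \<open>ennreal\<close> sends to 0.\<close>

definition cylinder :: "nat list \<Rightarrow> real set" where
  "cylinder ks = {x. tail_sum ks 1 < ennreal x \<and> ennreal x \<le> tail_sum ks 1 + excess ks 0}"

lemma cylinder_Nil: "cylinder [] = {1<..}"
proof -
  have "excess [] 0 = \<infinity>"
    using excess_Nil_1 excess_antimono[of 0 1 "[]"] by (simp add: top_unique)
  then show ?thesis by (auto simp: cylinder_def ennreal_1[symmetric] ennreal_less_iff simp del: ennreal_1)
qed

lemma sets_cylinder [measurable]: "cylinder ks \<in> sets borel"
  unfolding cylinder_def by measurable

text \<open>The points \<open>tail_sum ks 1 + excess ks k\<close> decrease in \<open>k\<close> and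
  divide the cylinder of \<open>ks\<close> into those of its children.\<close>

lemma cylinder_snoc:
  "cylinder (ks @ [Suc k]) =
    {x. tail_sum ks 1 + excess ks (real (Suc k)) < ennreal x \<and> ennreal x \<le> tail_sum ks 1 + excess ks (real k)}"
proof -
  have *: "tail_sum ks 1 + excess ks (real (Suc k)) + excess (ks @ [Suc k]) 0 = tail_sum ks 1 + excess ks (real k)"
    unfolding excess_snoc_0[of ks k, symmetric] by (simp add: ac_simps)
  show ?thesis unfolding cylinder_def tail_sum_snoc_1 * ..
qed

lemma cylinder_snoc_subset: "cylinder (ks @ [Suc k]) \<subseteq> cylinder ks"
proof
  fix x assume "x \<in> cylinder (ks @ [Suc k])"
  then have x: "tail_sum ks 1 + excess ks (real (Suc k)) < ennreal x" "ennreal x \<le> tail_sum ks 1 + excess ks (real k)"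
    by (auto simp: cylinder_snoc)
  have "tail_sum ks 1 \<le> tail_sum ks 1 + excess ks (real (Suc k))" by simp
  moreover have "tail_sum ks 1 + excess ks (real k) \<le> tail_sum ks 1 + excess ks 0"
    by (intro add_left_mono excess_antimono) simp
  ultimately show "x \<in> cylinder ks"
    unfolding cylinder_def mem_Collect_eq using x by (meson le_less_trans order_trans)
qed

lemma disjoint_family_cylinder_snoc: "disjoint_family (\<lambda>k. cylinder (ks @ [Suc k]))"
proof -
  have "cylinder (ks @ [Suc i]) \<inter> cylinder (ks @ [Suc j]) = {}" if "i < j" for i j
  proof -
    have "tail_sum ks 1 + excess ks (real j) \<le> tail_sum ks 1 + excess ks (real (Suc i))"
      using that by (intro add_left_mono excess_antimono) simp
    then have "\<not> tail_sum ks 1 + excess ks (real (Suc i)) < ennreal x"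
      if "ennreal x \<le> tail_sum ks 1 + excess ks (real j)" for x
      using that by (meson leD order_trans)
    then show ?thesis unfolding cylinder_snoc by blast
  qed
  then show ?thesis
    unfolding disjoint_family_on_def by (metis Int_commute linorder_neqE_nat)
qed

text \<open>Greedy choice of the next digit, possible because the division points approach
  \<open>zeta_star ks\<close> as the digit grows.\<close>

lemma cylinder_cover:
  assumes "x \<in> cylinder ks" "admissible_prefix ks"
  obtains k where "x \<in> cylinder (ks @ [Suc k])" "admissible_prefix (ks @ [Suc k])"
proof -
  define T where "T = zeta_star ks"
  have T: "tail_sum ks 1 = ennreal T" "T \<ge> 0"
    unfolding T_def by (rule tail_sum_1_eq_zeta_star[OF assms(2)], rule zeta_star_nonneg)
  have Tx: "T < x" using assms(1) T by (auto simp: cylinder_def ennreal_less_iff)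
  \<comment> \<open>The shift by 2: from exponent 2 on the excess is at most 1 even for the empty
    prefix, and it then decays at least like powers of \<open>1 / 2\<close>.\<close>
  have "(\<lambda>k. 2 powr - (real k - 2)) \<longlonglongrightarrow> 0" by real_asymp
  then have "\<forall>\<^sub>F k in sequentially. 2 powr - (real k - 2) < x - T"
    using Tx by (intro order_tendstoD) auto
  then have "\<forall>\<^sub>F k in sequentially. k \<ge> 2 \<and> 2 powr - (real k - 2) < x - T"
    using eventually_ge_at_top[of 2] by eventually_elim auto
  then obtain K :: nat where K: "K \<ge> 2" "2 powr - (real K - 2) < x - T"
    by (auto dest: eventually_happens)
  have "excess ks (real K) \<le> ennreal (2 powr - (real K - 2)) * excess ks 2"
    using K by (intro excess_le_powr) simp
  also have "\<dots> \<le> ennreal (2 powr - (real K - 2)) * 1"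
    using assms by (intro mult_left_mono excess_prefix_le_1) auto
  finally have "tail_sum ks 1 + excess ks (real K) \<le> ennreal T + ennreal (2 powr - (real K - 2))"
    using T by (simp add: add_left_mono)
  also have "\<dots> < ennreal x"
    using K T by (simp add: ennreal_plus[symmetric] ennreal_less_iff del: ennreal_plus)
  finally have ex: "\<exists>k::nat. tail_sum ks 1 + excess ks (real k) < ennreal x" by blast
  define k where "k = (LEAST k::nat. tail_sum ks 1 + excess ks (real k) < ennreal x)"
  have k: "tail_sum ks 1 + excess ks (real k) < ennreal x"
    unfolding k_def using ex by (rule LeastI_ex)
  have "k \<noteq> 0" using k assms(1) by (cases "k = 0") (auto simp: cylinder_def dest: leD)
  then obtain j where j: "k = Suc j" by (cases k) auto
  have "\<not> tail_sum ks 1 + excess ks (real j) < ennreal x"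
    using not_less_Least[of j "\<lambda>k. tail_sum ks 1 + excess ks (real k) < ennreal x"] j k_def by auto
  then have "x \<in> cylinder (ks @ [Suc j])"
    using k j by (simp add: cylinder_snoc not_less)
  moreover have "admissible_prefix (ks @ [Suc j])"
  proof -
    \<comment> \<open>A first digit 1 would need a division point at \<infinity> to lie below
      \<open>x\<close>.\<close>
    have "j \<noteq> 0" if "ks = []"
      using that k j excess_Nil_1 by (cases "j = 0") auto
    then show ?thesis using assms by (auto simp: admissible_prefix_snoc)
  qed
  ultimately show ?thesis by (rule that)
qed

lemma cylinder_eq_interval:
  assumes "excess ks 0 \<noteq> \<infinity>" "tail_sum ks 1 \<noteq> \<infinity>"
  shows "cylinder ks = {zeta_star ks<..zeta_star ks + enn2real (excess ks 0)}"
proof -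
  have T: "tail_sum ks 1 = ennreal (zeta_star ks)"
    using assms(2) unfolding zeta_star_eq by (simp only: ennreal_enn2real top.not_eq_extremum infinity_ennreal_def)
  have e: "excess ks 0 = ennreal (enn2real (excess ks 0))"
    using assms by (simp add: top.not_eq_extremum)
  show ?thesis
    unfolding cylinder_def T by (subst e) (auto simp: ennreal_less_iff zeta_star_nonneg ennreal_plus[symmetric] ennreal_le_iff simp del: ennreal_plus)
qed

lemma emeasure_cylinder_le: "emeasure lborel (cylinder ks) \<le> excess ks 0"
proof (cases "excess ks 0 = \<infinity> \<or> tail_sum ks 1 = \<infinity>")
  case True
  then show ?thesis by (auto simp: cylinder_def)
next
  case False
  then show ?thesis by (simp add: cylinder_eq_interval top.not_eq_extremum)
qed

section \<open>The convergent case\<close>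

text \<open>The recursion runs along the tree of digits so that measures can be compared with those
  of cylinders level by level. The two size conditions confine the cylinders involved to
  \<open>{..M + 1}\<close>.\<close>

primrec nearby :: "real \<Rightarrow> real \<Rightarrow> nat \<Rightarrow> nat list \<Rightarrow> real set" where
  "nearby c M 0 ks =
     (if excess ks 0 \<le> 1 \<and> tail_sum ks 1 \<le> ennreal M
      then {x. \<bar>x - zeta_star ks\<bar> < approx_radius ks c} else {})"
| "nearby c M (Suc t) ks = (\<Union>k. nearby c M t (ks @ [Suc k]))"

lemma nearbyI:
  assumes "\<forall>j\<in>set js. j \<ge> 1" "excess (ks @ js) 0 \<le> 1" "tail_sum (ks @ js) 1 \<le> ennreal M"
    "\<bar>x - zeta_star (ks @ js)\<bar> < approx_radius (ks @ js) c"
  shows "x \<in> nearby c M (length js) ks"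
  using assms
proof (induction js arbitrary: ks)
  case Nil
  then show ?case by simp
next
  case (Cons j js)
  then have "x \<in> nearby c M (length js) (ks @ [j])" by simp
  moreover obtain k where "j = Suc k" using Cons.prems by (cases j) auto
  ultimately show ?case by auto
qed

lemma sets_nearby [measurable]: "nearby c M t ks \<in> sets borel"
proof (induction t arbitrary: ks)
  case 0
  have "{x. \<bar>x - zeta_star ks\<bar> < approx_radius ks c} \<in> sets borel" by measurable
  then show ?case by simp
qed auto

text \<open>A ball is twice as long as its radius, hence at most \<open>2 * 2 powr - c\<close> times
  as long as its cylinder. The cylinders of the children are disjoint and lie in that of the parent,
  so the factor does not grow with \<open>t\<close>.\<close>

lemma emeasure_nearby_le:
  assumes "M \<ge> 0"  "c \<ge> 0"
  shows "emeasure lborel (nearby c M t ks) \<le>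
    ennreal (2 * 2 powr - c) * emeasure lborel (cylinder ks \<inter> {..M + 1})"
proof (induction t arbitrary: ks)
  case 0
  show ?case
  proof (cases "excess ks 0 \<le> 1 \<and> tail_sum ks 1 \<le> ennreal M")
    case True
    define L where "L = enn2real (excess ks 0)"
    have fin: "excess ks 0 \<noteq> \<infinity>" "tail_sum ks 1 \<noteq> \<infinity>"
      using True by (auto simp: top_unique)
    have L: "excess ks 0 = ennreal L"
      unfolding L_def using fin by (simp add: top.not_eq_extremum)
    have "L \<le> 1" unfolding L_def using True by (intro enn2real_leI) auto
    have "zeta_star ks \<le> M" unfolding zeta_star_eq using True assms by (intro enn2real_leI) auto
    with \<open>L \<le> 1\<close> have cyl: "cylinder ks \<inter> {..M + 1} = {zeta_star ks<..zeta_star ks + L}"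
      using cylinder_eq_interval[OF fin] by (auto simp: L_def)
    have "excess ks c \<le> ennreal (2 powr - c) * ennreal L"
      using excess_le_powr[of 0 c ks] assms L by simp
    also have "\<dots> = ennreal (2 powr - c * L)"
      by (simp add: ennreal_mult'' L_def)
    finally have "approx_radius ks c \<le> 2 powr - c * L"
      unfolding approx_radius_eq by (intro enn2real_leI) (auto simp: L_def)
    moreover have "{x. \<bar>x - zeta_star ks\<bar> < approx_radius ks c} =
        {zeta_star ks - approx_radius ks c<..<zeta_star ks + approx_radius ks c}"
      by (auto simp: abs_less_iff)
    moreover have "approx_radius ks c \<ge> 0" by (simp add: approx_radius_eq)
    ultimately show ?thesis
      using True cyl by (auto simp: L_def ennreal_mult[symmetric] intro!: ennreal_leI)
  next
    case False
    then have "nearby c M 0 ks = {}" by (simp only: nearby.simps if_False)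
    then show ?thesis by simp
  qed
next
  case (Suc t)
  have "emeasure lborel (nearby c M (Suc t) ks) \<le> (\<Sum>k. emeasure lborel (nearby c M t (ks @ [Suc k])))"
    unfolding nearby.simps by (intro emeasure_subadditive_countably) auto
  also have "\<dots> \<le> (\<Sum>k. ennreal (2 * 2 powr - c) * emeasure lborel (cylinder (ks @ [Suc k]) \<inter> {..M + 1}))"
    by (intro suminf_le Suc.IH) auto
  also have "\<dots> = ennreal (2 * 2 powr - c) * (\<Sum>k. emeasure lborel (cylinder (ks @ [Suc k]) \<inter> {..M + 1}))"
    by simp
  also have "(\<Sum>k. emeasure lborel (cylinder (ks @ [Suc k]) \<inter> {..M + 1})) =
      emeasure lborel (\<Union>k. cylinder (ks @ [Suc k]) \<inter> {..M + 1})"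
    using disjoint_family_cylinder_snoc[of ks]
    by (intro suminf_emeasure) (auto simp: disjoint_family_on_def)
  also have "\<dots> \<le> emeasure lborel (cylinder ks \<inter> {..M + 1})"
    using cylinder_snoc_subset[of ks] by (intro emeasure_mono) auto
  finally show ?case by (simp add: mult_left_mono)
qed

lemma emeasure_nearby_Nil_le:
  assumes "M \<ge> 0" "c \<ge> 0"
  shows "emeasure lborel (nearby c M t []) \<le> ennreal (2 * M * 2 powr - c)"
proof -
  have "cylinder [] \<inter> {..M + 1} = {1<..M + 1}" by (auto simp: cylinder_Nil)
  then show ?thesis
    using emeasure_nearby_le[OF assms, of t "[]"] assms
    by (simp add: ennreal_mult[symmetric] mult_ac)
qed

text \<open>Borel-Cantelli is applied for each \<open>M\<close> separately, and the exceptional sets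
  are united over all \<open>M\<close>.\<close>

lemma approximable_set_null:
  fixes f :: "nat \<Rightarrow> real"
  assumes f: "\<And>r. r \<ge> 1 \<Longrightarrow> f r \<ge> 1" and sum: "summable (\<lambda>r. 1 / 2 powr f (Suc r))"
  shows "approximable_set f \<in> null_sets lebesgue"
proof -
  define A where "A M n = nearby (f (Suc n)) (real M) (Suc n) []" for M n
  have A: "emeasure lborel (A M n) \<le> ennreal (2 * real M * 2 powr - f (Suc n))" for M n
    unfolding A_def using f[of "Suc n"] by (intro emeasure_nearby_Nil_le) auto
  have "limsup (A M) \<in> null_sets lborel" for M
  proof (rule borel_cantelli_limsup1)
    show "A M n \<in> sets lborel" for n by (simp add: A_def del: nearby.simps)
    show "emeasure lborel (A M n) < \<infinity>" for n
      using A[of M n] by (simp add: le_less_trans)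
    have "summable (\<lambda>n. 2 * real M * (1 / 2 powr f (Suc n)))"
      using sum by (rule summable_mult)
    then show "summable (\<lambda>n. measure lborel (A M n))"
    proof (rule summable_comparison_test')
      show "norm (measure lborel (A M n)) \<le> 2 * real M * (1 / 2 powr f (Suc n))" for n
        using A[of M n] by (simp add: measure_def powr_minus_divide enn2real_leI)
    qed
  qed
  then have "(\<Union>M. limsup (A M)) \<in> null_sets lborel" by (rule null_sets_UN)
  then have "(\<Union>M. limsup (A M)) \<in> null_sets lebesgue" by (rule null_sets_completionI)
  moreover have "approximable_set f \<subseteq> (\<Union>M. limsup (A M))"
  proof
    fix x assume "x \<in> approximable_set f"
    then have x: "x > 1" and inf: "infinite {r. r \<ge> 1 \<and> (\<exists>ks. length ks = r \<and> admissible ks \<and>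
             \<bar>x - zeta_star ks\<bar> < approx_radius ks (f r))}" (is "infinite ?R")
      by (auto simp: approximable_set_def)
    \<comment> \<open>The radius is at most 1, so the zeta-star values that approximate
      \<open>x\<close> are at most \<open>x + 1\<close>.\<close>
    define M where "M = nat \<lceil>x + 1\<rceil>"
    have M: "x + 1 \<le> real M" unfolding M_def by linarith
    have "\<exists>m\<ge>n. x \<in> A M m" for n
    proof -
      \<comment> \<open>The choice \<open>r > 2 * M\<close> rules out cylinders longer than 1, whose
        zeta-star values are at least \<open>1 + r / 2\<close>.\<close>
      obtain r where r: "r > max n (2 * M)" "r \<in> ?R"
        using inf by (meson infinite_nat_iff_unbounded)
      then obtain ks where ks: "length ks = r" "admissible ks" "\<bar>x - zeta_star ks\<bar> < approx_radius ks (f r)" "r \<ge> 1"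
        by blast
      have "excess ks (f r) \<le> 1" using ks f by (intro excess_le_1) auto
      then have "approx_radius ks (f r) \<le> 1"
        unfolding approx_radius_eq by (intro enn2real_leI) auto
      then have "zeta_star ks \<le> real M" using ks M by linarith
      moreover have ap: "admissible_prefix ks" using ks by (simp add: admissible_prefix_def)
      ultimately have T: "tail_sum ks 1 \<le> ennreal (real M)"
        by (simp add: tail_sum_1_eq_zeta_star ennreal_leI del: One_nat_def)
      have "excess ks 0 \<le> 1"
      proof (rule ccontr)
        assume "\<not> excess ks 0 \<le> 1"
        then have "ennreal (1 + real (length ks) / 2) \<le> ennreal (real M)"
          using excess_le_1_or_tail_sum_ge[OF ap] T by (auto intro: order_trans)
        then have "1 + real r / 2 \<le> real M" using ks by (simp add: ennreal_le_iff del: ennreal_plus)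
        then show False using r by simp
      qed
      moreover have "\<forall>k\<in>set ks. k \<ge> 1" using ks by (simp add: admissible_def)
      ultimately have "x \<in> nearby (f r) (real M) (length ks) []"
        using T ks by (intro nearbyI) (auto simp del: One_nat_def)
      \<comment> \<open>The set \<open>A M n\<close> belongs to tuples of length
        \<open>n + 1\<close>.\<close>
      then have "x \<in> A M (r - 1)" using ks by (simp add: A_def del: nearby.simps)
      then show ?thesis using r by (intro exI[of _ "r - 1"]) auto
    qed
    then have "x \<in> limsup (A M)" by (auto simp: limsup_INF_SUP)
    then show "x \<in> (\<Union>M. limsup (A M))" by blast
  qed
  ultimately show ?thesis by (rule null_sets_completion_subset[rotated])
qed

section \<open>Survival probabilities of the hidden Markov chain\<close>

text \<open>In the state \<open>m\<close> the digit \<open>Suc k\<close> has probability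
  \<open>(m - 1) / m ^ Suc k\<close> and each next state \<open>1 / (m - 1)\<close>; the factors
  \<open>m - 1\<close> cancel.\<close>

primrec survival :: "(nat \<Rightarrow> nat) \<Rightarrow> nat \<Rightarrow> nat \<Rightarrow> nat \<Rightarrow> real" where
  "survival s 0 i m = 1"
| "survival s (Suc t) i m =
     (\<Sum>k<s i. 1 / real m ^ Suc k) * (\<Sum>n=2..m. survival s t (Suc i) n)"

lemma survival_nonneg: "survival s t i m \<ge> 0"
  by (induction t arbitrary: i m) (auto intro!: mult_nonneg_nonneg sum_nonneg)

lemma sum_inverse_powers:
  assumes "m \<ge> 2"
  shows "(\<Sum>k<l. 1 / real m ^ Suc k) = (1 - 1 / real m ^ l) / (real m - 1)"
proof (induction l)
  case (Suc l)
  show ?case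
    unfolding sum.lessThan_Suc Suc.IH using assms by (simp add: field_simps)
qed simp

lemma sum_inverse_powers_le:
  assumes "m \<ge> 2"
  shows "(\<Sum>k<l. 1 / real m ^ Suc k) \<le> 1 / (real m - 1)"
  unfolding sum_inverse_powers[OF assms] using assms by (intro divide_right_mono) auto

text \<open>Dropping the restriction on the first digit leaves the average over the next
  states.\<close>

lemma survival_Suc_le:
  assumes "m \<ge> 2"
  shows "survival s (Suc t) i m \<le> (\<Sum>n=2..m. survival s t (Suc i) n) / (real m - 1)"
proof -
  have "survival s (Suc t) i m \<le> 1 / (real m - 1) * (\<Sum>n=2..m. survival s t (Suc i) n)"
    unfolding survival.simps using assms
    by (intro mult_right_mono sum_inverse_powers_le sum_nonneg survival_nonneg)
  then show ?thesis by simp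
qed

lemma survival_le_1:
  assumes "m \<ge> 2"
  shows "survival s t i m \<le> 1"
  using assms
proof (induction t arbitrary: i m)
  case (Suc t)
  have "(\<Sum>n=2..m. survival s t (Suc i) n) \<le> (\<Sum>n=2..m. 1)"
    using Suc.IH by (intro sum_mono) auto
  also have "\<dots> = real m - 1" using Suc.prems by (simp add: of_nat_diff)
  finally have "(\<Sum>n=2..m. survival s t (Suc i) n) / (real m - 1) \<le> 1"
    using Suc.prems by simp
  with survival_Suc_le[OF Suc.prems] show ?case by (rule order_trans)
qed simp

text \<open>The state 2 is absorbing, and there a digit exceeds \<open>l\<close> with probability
  \<open>1 / 2 ^ l\<close>, independently of the others.\<close>

lemma survival_2: "survival s t i 2 = (\<Prod>j<t. 1 - 1 / 2 ^ s (i + j))"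
proof (induction t arbitrary: i)
  case (Suc t)
  have "survival s (Suc t) i 2 = (1 - 1 / 2 ^ s i) * (\<Prod>j<t. 1 - 1 / 2 ^ s (Suc i + j))"
    using sum_inverse_powers[of 2 "s i"] Suc.IH by simp
  then show ?case by (simp add: prod.lessThan_Suc_shift del: prod.lessThan_Suc)
qed simp

text \<open>By \<open>1 - a \<le> exp (- a)\<close> the product is at most the exponential of minus
  the diverging partial sums.\<close>

lemma prod_one_minus_tendsto_0:
  fixes a :: "nat \<Rightarrow> real"
  assumes "\<And>j. 0 \<le> a j" "\<And>j. a j \<le> 1" "\<not> summable a"
  shows "(\<lambda>t. \<Prod>j<t. 1 - a j) \<longlonglongrightarrow> 0"
proof (rule tendsto_sandwich[OF _ _ tendsto_const])
  have "filterlim (\<lambda>t. \<Sum>j<t. a j) at_top sequentially"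
  proof (rule ccontr)
    assume "\<not> filterlim (\<lambda>t. \<Sum>j<t. a j) at_top sequentially"
    then obtain B where B: "\<not> (\<forall>\<^sub>F t in sequentially. B \<le> (\<Sum>j<t. a j))"
      by (auto simp: filterlim_at_top)
    have "(\<Sum>j<t. a j) \<le> B" for t
    proof (rule ccontr)
      assume t: "\<not> (\<Sum>j<t. a j) \<le> B"
      have "B \<le> (\<Sum>j<u. a j)" if "u \<ge> t" for u
        using t sum_mono2[of "{..<u}" "{..<t}" a] that assms(1) by auto
      with B show False by (auto simp: eventually_sequentially)
    qed
    then have "summable a"
      using assms(1) by (intro summableI_nonneg_bounded)
    with assms(3) show False by simp
  qed
  then show "(\<lambda>t. exp (- (\<Sum>j<t. a j))) \<longlonglongrightarrow> 0"
    by (intro filterlim_compose[OF exp_at_bot] filterlim_compose[OF filterlim_uminus_at_bot_at_top])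
  show "\<forall>\<^sub>F t in sequentially. 0 \<le> (\<Prod>j<t. 1 - a j)"
    using assms by (intro always_eventually allI prod_nonneg) auto
  have "(\<Prod>j<t. 1 - a j) \<le> exp (- (\<Sum>j<t. a j))" for t
  proof -
    have "(\<Prod>j<t. 1 - a j) \<le> (\<Prod>j<t. exp (- a j))"
      using assms exp_ge_add_one_self[of "- a _"] by (intro prod_mono) auto
    then show ?thesis by (simp add: exp_sum sum_negf[symmetric])
  qed
  then show "\<forall>\<^sub>F t in sequentially. (\<Prod>j<t. 1 - a j) \<le> exp (- (\<Sum>j<t. a j))" by simp
qed

lemma survival_tendsto_0:
  assumes s: "\<not> summable (\<lambda>i. 1 / 2 ^ s i :: real)" and "m \<ge> 2"
  shows "(\<lambda>t. survival s t i m) \<longlonglongrightarrow> 0"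
  using \<open>m \<ge> 2\<close>
proof (induction m arbitrary: i rule: less_induct)
  case (less m)
  show ?case
  proof (cases "m = 2")
    case True
    have "\<not> summable (\<lambda>j. 1 / 2 ^ s (j + i) :: real)"
      using s by (subst summable_iff_shift)
    then have "(\<lambda>t. \<Prod>j<t. 1 - 1 / 2 ^ s (i + j)) \<longlonglongrightarrow> (0::real)"
      by (intro prod_one_minus_tendsto_0) (auto simp: add.commute)
    with True show ?thesis by (simp add: survival_2)
  next
    case False
    with less.prems have m: "m \<ge> 3" by simp
    \<comment> \<open>A step from \<open>m \<ge> 3\<close> stays at \<open>m\<close> with
      probability at most \<open>1 / 2\<close>, hence the powers of \<open>1 / 2\<close>; moves to
      smaller states are negligible by the outer induction and are absorbed in
      \<open>e\<close>.\<close>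
    have "\<forall>\<^sub>F t in sequentially. survival s t i m < 1 / 2 ^ j + e" if "e > 0" for e j i
      using that
    proof (induction j arbitrary: i e)
      case 0
      have "survival s t i m < 1 / 2 ^ 0 + e" for t
        using survival_le_1[OF less.prems, of s t i] 0 by simp
      then show ?case by simp
    next
      case (Suc j)
      have "(\<lambda>t. \<Sum>n=2..<m. survival s t (Suc i) n) \<longlonglongrightarrow> (\<Sum>n=2..<m. 0)"
        using less.IH by (intro tendsto_sum) auto
      then have "\<forall>\<^sub>F t in sequentially. (\<Sum>n=2..<m. survival s t (Suc i) n) < e"
        using Suc.prems by (intro order_tendstoD) auto
      moreover have "\<forall>\<^sub>F t in sequentially. survival s t (Suc i) m < 1 / 2 ^ j + e"
        by (rule Suc.IH) fact
      ultimately have "\<forall>\<^sub>F t in sequentially. survival s (Suc t) i m < 1 / 2 ^ Suc j + e"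
      proof eventually_elim
        case (elim t)
        have "{2..m} = insert m {2..<m}" using less.prems by auto
        then have "survival s (Suc t) i m \<le>
            (survival s t (Suc i) m + (\<Sum>n=2..<m. survival s t (Suc i) n)) / (real m - 1)"
          using survival_Suc_le[OF less.prems, of s t i] by simp
        also have "\<dots> \<le> (survival s t (Suc i) m + (\<Sum>n=2..<m. survival s t (Suc i) n)) / 2"
          using m by (intro divide_left_mono add_nonneg_nonneg sum_nonneg survival_nonneg) auto
        \<comment> \<open>One \<open>e\<close> comes from the state \<open>m\<close>, the other from
          the smaller states; halving restores the margin \<open>e\<close>.\<close>
        also have "\<dots> < (1 / 2 ^ j + e + e) / 2" using elim by simp
        also have "\<dots> = 1 / 2 ^ Suc j + e" by simp
        finally show ?case .
      qed
      then show ?case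
        by (subst (asm) eventually_sequentially_Suc)
    qed
    note bound = this
    show ?thesis
    proof (rule order_tendstoI)
      fix a :: real assume "a < 0"
      then show "\<forall>\<^sub>F t in sequentially. a < survival s t i m"
        using survival_nonneg by (intro always_eventually allI) (rule less_le_trans)
    next
      fix a :: real assume "0 < a"
      then obtain j where "1 / 2 ^ j < a / 2"
        using real_arch_pow_inv[of "a / 2" "1 / 2"] by (auto simp: power_one_over)
      with bound[of "a / 2" i j] \<open>0 < a\<close> show "\<forall>\<^sub>F t in sequentially. survival s t i m < a"
        by (auto elim!: eventually_mono)
    qed
  qed
qed

section \<open>The divergent case\<close>

text \<open>The points of the cylinder whose next \<open>t\<close> digits are at most
  \<open>s i\<close>, \<open>s (i + 1)\<close> and so on.\<close>

primrec survivors :: "(nat \<Rightarrow> nat) \<Rightarrow> nat \<Rightarrow> nat \<Rightarrow> nat list \<Rightarrow> real set" where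
  "survivors s 0 i ks = cylinder ks"
| "survivors s (Suc t) i ks = (\<Union>k<s i. survivors s t (Suc i) (ks @ [Suc k]))"

lemma sets_survivors [measurable]: "survivors s t i ks \<in> sets borel"
  by (induction t arbitrary: i ks) auto

text \<open>Up to normalisation, \<open>tail_sum ks\<close> on \<open>{2..}\<close> is the law of the hidden state after the digits
  \<open>ks\<close>, and \<open>survival s t i m\<close> is the probability that the next \<open>t\<close> digits from the state \<open>m\<close>
  are bounded by \<open>s i, s (i + 1), \<dots>\<close>\<close>

lemma emeasure_survivors_le:
  "emeasure lborel (survivors s t i ks) \<le>
    (\<integral>\<^sup>+m. tail_sum ks m * ennreal (survival s t i m) \<partial>count_space {2..})"
proof (induction t arbitrary: i ks)
  case 0
  then show ?case using emeasure_cylinder_le[of ks] by (simp add: excess_0)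
next
  case (Suc t)
  let ?Q = "\<lambda>m. \<Sum>n=2..m. survival s t (Suc i) n"
  have Q: "?Q m \<ge> 0" for m by (intro sum_nonneg survival_nonneg)
  have "emeasure lborel (survivors s (Suc t) i ks) \<le>
      (\<Sum>k<s i. emeasure lborel (survivors s t (Suc i) (ks @ [Suc k])))"
    unfolding survivors.simps by (intro emeasure_subadditive_finite) auto
  also have "\<dots> \<le> (\<Sum>k<s i. \<integral>\<^sup>+n. tail_sum (ks @ [Suc k]) n * ennreal (survival s t (Suc i) n) \<partial>count_space {2..})"
    by (intro sum_mono Suc.IH)
  also have "\<dots> = (\<Sum>k<s i. \<integral>\<^sup>+m. tail_sum ks m * ennreal (1 / real m ^ Suc k * ?Q m) \<partial>count_space {2..})"
    by (intro sum.cong refl nn_integral_tail_sum_snoc survival_nonneg)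
  also have "\<dots> = (\<integral>\<^sup>+m. (\<Sum>k<s i. tail_sum ks m * ennreal (1 / real m ^ Suc k * ?Q m)) \<partial>count_space {2..})"
    by (rule nn_integral_sum[symmetric]) auto
  also have "\<dots> = (\<integral>\<^sup>+m. tail_sum ks m * ennreal (survival s (Suc t) i m) \<partial>count_space {2..})"
  proof (intro nn_integral_cong)
    fix m :: nat
    have "(\<Sum>k<s i. ennreal (1 / real m ^ Suc k * ?Q m)) = ennreal (\<Sum>k<s i. 1 / real m ^ Suc k * ?Q m)"
      using Q by (intro sum_ennreal mult_nonneg_nonneg) auto
    then show "(\<Sum>k<s i. tail_sum ks m * ennreal (1 / real m ^ Suc k * ?Q m)) =
        tail_sum ks m * ennreal (survival s (Suc t) i m)"
      by (simp only: sum_distrib_left[symmetric] survival.simps sum_distrib_right)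
  qed
  finally show ?case .
qed

text \<open>Dominated convergence with the majorant \<open>tail_sum ks\<close>, whose integral is
  \<open>excess ks 0\<close>.\<close>

lemma survivors_null:
  assumes "\<not> summable (\<lambda>i. 1 / 2 ^ s i :: real)" "excess ks 0 \<noteq> \<infinity>"
  shows "(\<Inter>t. survivors s t i ks) \<in> null_sets lborel"
proof -
  have "(\<lambda>t. \<integral>\<^sup>+m. tail_sum ks m * ennreal (survival s t i m) \<partial>count_space {2..})
      \<longlonglongrightarrow> (\<integral>\<^sup>+m. 0 \<partial>count_space {2::nat..})"
  proof (rule nn_integral_dominated_convergence[where w = "tail_sum ks"])
    show "AE m in count_space {2..}. tail_sum ks m * ennreal (survival s t i m) \<le> tail_sum ks m" for t
    proof (rule AE_I2)
      fix m assume "m \<in> space (count_space {2::nat..})"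
      then have "ennreal (survival s t i m) \<le> 1"
        using survival_le_1[of m s t i] by (simp flip: ennreal_1 add: ennreal_leI)
      then show "tail_sum ks m * ennreal (survival s t i m) \<le> tail_sum ks m"
        using mult_left_mono[of "ennreal (survival s t i m)" 1 "tail_sum ks m"] by simp
    qed
    show "(\<integral>\<^sup>+m. tail_sum ks m \<partial>count_space {2..}) < \<infinity>"
      using assms(2) by (simp add: excess_0 top.not_eq_extremum)
    \<comment> \<open>In \<open>ennreal\<close>, multiplication by \<infinity> is not continuous at
      0.\<close>
    have fin: "tail_sum ks m \<noteq> \<infinity>" if "m \<ge> 2" for m
      using assms(2) nn_integral_PInf_AE[of "tail_sum ks" "count_space {2..}"] that
      by (auto simp: excess_0 AE_count_space)
    show "AE m in count_space {2..}. (\<lambda>t. tail_sum ks m * ennreal (survival s t i m)) \<longlonglongrightarrow> 0"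
    proof (rule AE_I2)
      fix m assume "m \<in> space (count_space {2::nat..})"
      then have m: "m \<ge> 2" by simp
      have "(\<lambda>t. ennreal (survival s t i m)) \<longlonglongrightarrow> ennreal 0"
        by (intro tendsto_ennrealI survival_tendsto_0 assms m)
      then have "(\<lambda>t. tail_sum ks m * ennreal (survival s t i m)) \<longlonglongrightarrow> tail_sum ks m * ennreal 0"
        using fin[OF m] by (intro ennreal_tendsto_cmult) (auto simp: top.not_eq_extremum)
      then show "(\<lambda>t. tail_sum ks m * ennreal (survival s t i m)) \<longlonglongrightarrow> 0" by simp
    qed
  qed auto
  then have lim: "(\<lambda>t. \<integral>\<^sup>+m. tail_sum ks m * ennreal (survival s t i m) \<partial>count_space {2..}) \<longlonglongrightarrow> 0"
    by simp
  have "emeasure lborel (\<Inter>t. survivors s t i ks) \<le> 0"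
  proof (rule LIMSEQ_le_const[OF lim], intro exI allI impI)
    fix t :: nat
    have "emeasure lborel (\<Inter>t. survivors s t i ks) \<le> emeasure lborel (survivors s t i ks)"
      by (intro emeasure_mono) auto
    then show "emeasure lborel (\<Inter>t. survivors s t i ks) \<le>
        (\<integral>\<^sup>+m. tail_sum ks m * ennreal (survival s t i m) \<partial>count_space {2..})"
      using emeasure_survivors_le order_trans by blast
  qed
  then show ?thesis by (intro null_setsI) auto
qed

text \<open>The expansion of \<open>x\<close> is followed digit by digit; with
  \<open>length ks\<close> as position, the bounds stay in step with the digits.\<close>

lemma survivorsI:
  assumes "\<And>ks. x \<in> cylinder ks \<Longrightarrow> admissible_prefix ks \<Longrightarrow> length ks \<ge> i \<Longrightarrow>
      \<exists>k<s (length ks). x \<in> cylinder (ks @ [Suc k]) \<and> admissible_prefix (ks @ [Suc k])"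
    and "x \<in> cylinder ks" "admissible_prefix ks" "length ks \<ge> i"
  shows "x \<in> survivors s t (length ks) ks"
  using assms(2-)
proof (induction t arbitrary: ks)
  case (Suc t)
  from assms(1)[OF Suc.prems] obtain k where k: "k < s (length ks)" "x \<in> cylinder (ks @ [Suc k])"
    "admissible_prefix (ks @ [Suc k])" by blast
  with Suc.IH[OF k(2,3)] Suc.prems show ?case by auto
qed simp

text \<open>A larger digit would place \<open>x\<close> within half the radius to the right of
  \<open>zeta_star ks\<close>.\<close>

lemma digit_bound:
  assumes x: "x \<in> cylinder (ks @ [Suc k])" and ks: "admissible ks" and c: "c \<ge> 1"
    and far: "approx_radius ks c \<le> \<bar>x - zeta_star ks\<bar>"
  shows "k < nat \<lceil>c\<rceil> + 1"
proof (rule ccontr)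
  assume "\<not> k < nat \<lceil>c\<rceil> + 1"
  then have k: "c + 1 \<le> real k" by linarith
  define a where "a = approx_radius ks c"
  have "excess ks c < \<infinity>" using excess_le_1[OF ks c] by (simp add: le_less_trans)
  then have a: "excess ks c = ennreal a" "a \<ge> 0"
    unfolding a_def approx_radius_eq by simp_all
  have T: "tail_sum ks 1 = ennreal (zeta_star ks)"
    using ks by (intro tail_sum_1_eq_zeta_star) (simp add: admissible_prefix_def)
  have "x \<in> cylinder ks" using x cylinder_snoc_subset by blast
  then have zx: "zeta_star ks < x" 
    by (simp add: cylinder_def T ennreal_less_iff zeta_star_nonneg del: One_nat_def)
  have "excess ks (real k) \<le> ennreal (2 powr - (real k - c)) * excess ks c"
    using k by (intro excess_le_powr) simp
  also have "\<dots> \<le> ennreal (1 / 2) * ennreal a"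
    unfolding a(1) using k powr_mono[of "- (real k - c)" "-1" 2]
    by (intro mult_right_mono ennreal_leI) (auto simp: powr_minus_divide)
  also have "\<dots> = ennreal (a / 2)" using a(2) ennreal_mult[of "1 / 2" a] by simp
  finally have "ennreal x \<le> ennreal (zeta_star ks) + ennreal (a / 2)"
    using x unfolding cylinder_snoc T mem_Collect_eq by (meson add_left_mono order_trans)
  then have "x \<le> zeta_star ks + a / 2"
    using a(2) zeta_star_nonneg[of ks] by (simp add: ennreal_plus[symmetric] ennreal_le_iff del: ennreal_plus)
  \<comment> \<open>From \<open>a \<le> a / 2\<close> follows \<open>a = 0\<close>, which
    contradicts \<open>zeta_star ks < x\<close>.\<close>
  with far zx a(2) show False unfolding a_def by linarith
qed

text \<open>A point outside the set is far from the zeta-star values of all long tuples, so by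
  \<open>digit_bound\<close> its digits are bounded from some position on.\<close>

lemma approximable_set_conull:
  fixes f :: "nat \<Rightarrow> real"
  assumes f: "\<And>r. r \<ge> 1 \<Longrightarrow> f r \<ge> 1" and sum: "\<not> summable (\<lambda>r. 1 / 2 powr f (Suc r))"
  shows "{1<..} - approximable_set f \<in> null_sets lebesgue"
proof -
  \<comment> \<open>Here \<open>s i\<close> bounds the digit that follows a tuple of length
    \<open>i\<close>, in the form given by \<open>digit_bound\<close>.\<close>
  define s where "s i = nat \<lceil>f i\<rceil> + 1" for i
  have s: "\<not> summable (\<lambda>i. 1 / 2 ^ s i :: real)"
  proof
    assume "summable (\<lambda>i. 1 / 2 ^ s i :: real)"
    then have "summable (\<lambda>i. 4 * (1 / 2 ^ s (i + 1)) :: real)"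
      by (intro summable_mult) (subst summable_iff_shift)
    then have "summable (\<lambda>r. 1 / 2 powr f (Suc r))"
    proof (rule summable_comparison_test')
      fix r :: nat
      \<comment> \<open>Rounding up and the summand 1 cost at most 2 in the exponent, hence the
        factor 4.\<close>
      have "real (s (Suc r)) \<le> f (Suc r) + 2"
        using f[of "Suc r"] unfolding s_def by linarith
      then have "2 powr real (s (Suc r)) \<le> 2 powr (f (Suc r) + 2)"
        by (intro powr_mono) auto
      then have "2 ^ s (Suc r) \<le> 4 * 2 powr f (Suc r)"
        by (simp add: powr_add powr_realpow)
      then show "norm (1 / 2 powr f (Suc r)) \<le> 4 * (1 / 2 ^ s (r + 1))"
        by (simp add: field_simps)
    qed
    with sum show False ..
  qed
  \<comment> \<open>A countable union, since there are countably many lists of digits.\<close>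
  define N where "N = (\<Union>ks\<in>{ks. excess ks 0 \<noteq> \<infinity>}. \<Inter>t. survivors s t (length ks) ks)"
  have "N \<in> null_sets lborel"
    unfolding N_def using s by (intro null_sets_UN' survivors_null) auto
  then have "N \<in> null_sets lebesgue" by (rule null_sets_completionI)
  moreover have "{1<..} - approximable_set f \<subseteq> N"
  proof
    fix x assume x: "x \<in> {1<..} - approximable_set f"
    then obtain R where R: "\<And>r. r \<in> {r. r \<ge> 1 \<and> (\<exists>ks. length ks = r \<and> admissible ks \<and>
             \<bar>x - zeta_star ks\<bar> < approx_radius ks (f r))} \<Longrightarrow> r \<le> R"
      unfolding approximable_set_def by (auto simp: finite_nat_set_iff_bounded_le)
    have far: "approx_radius ks (f (length ks)) \<le> \<bar>x - zeta_star ks\<bar>"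
      if "admissible ks" "length ks > R" for ks
      using R[of "length ks"] that by (fastforce simp: admissible_def not_less)
    \<comment> \<open>The first term makes \<open>far\<close> apply from length \<open>B\<close> on;
      the second forces a cylinder of length at most 1, as otherwise
      \<open>1 + B / 2 < x\<close>.\<close>
    define B where "B = max (Suc R) (nat \<lceil>2 * x\<rceil>)"
    have "\<exists>ks. x \<in> cylinder ks \<and> admissible_prefix ks \<and> length ks = l" for l
    proof (induction l)
      case 0
      then show ?case using x by (auto simp: cylinder_Nil admissible_prefix_def)
    next
      case (Suc l)
      then show ?case by (metis cylinder_cover length_append_singleton)
    qed
    then obtain ks where ks: "x \<in> cylinder ks" "admissible_prefix ks" "length ks = B" by blast
    have "excess ks 0 \<le> 1"
    proof (rule ccontr)
      assume "\<not> excess ks 0 \<le> 1"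
      then have "ennreal (1 + real B / 2) \<le> tail_sum ks 1"
        using excess_le_1_or_tail_sum_ge[OF ks(2)] ks(3) by auto
      also have "\<dots> < ennreal x" using ks(1) by (simp add: cylinder_def)
      finally have "1 + real B / 2 < x" by (simp add: ennreal_less_iff del: ennreal_plus)
      moreover have "2 * x \<le> real B" unfolding B_def by linarith
      ultimately show False by linarith
    qed
    then have fin: "excess ks 0 \<noteq> \<infinity>" by (auto simp: top_unique)
    have "x \<in> survivors s t (length ks) ks" for t
    proof (rule survivorsI[where i = B])
      fix js assume js: "x \<in> cylinder js" "admissible_prefix js" "B \<le> length js"
      then obtain k where k: "x \<in> cylinder (js @ [Suc k])" "admissible_prefix (js @ [Suc k])"
        using cylinder_cover by blast
      have "length js > R" using js(3) by (simp add: B_def)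
      moreover from this have "admissible js" using js(2) by (auto simp: admissible_prefix_def)
      ultimately have "k < s (length js)"
        unfolding s_def using k(1) f[of "length js"] far by (intro digit_bound) auto
      with k show "\<exists>k<s (length js). x \<in> cylinder (js @ [Suc k]) \<and> admissible_prefix (js @ [Suc k])" by blast
    qed (use ks in auto)
    with fin show "x \<in> N" unfolding N_def by blast
  qed
  ultimately show ?thesis by (rule null_sets_completion_subset[rotated])
qed

theorem theorem1p2:
  fixes f :: "nat \<Rightarrow> real"
  assumes "\<And>r. r \<ge> 1 \<Longrightarrow> f r \<ge> 1"
  shows "(summable (\<lambda>r. 1 / 2 powr f (Suc r)) \<longrightarrow>
            approximable_set f \<in> null_sets lebesgue) \<and>
         (\<not> summable (\<lambda>r. 1 / 2 powr f (Suc r)) \<longrightarrow>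
            {1<..} - approximable_set f \<in> null_sets lebesgue)"
  using approximable_set_null[of f] approximable_set_conull[of f] assms by blast

end
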